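(* Let $G$ be a finite unoriented graph and let $c:E(G\times K_2)\to[0,\infty]$ be a capacity on the bunkbed graph $G\times K_2$ that is reflection-symmetric, i.e. $c(e_0)=c(e_1)$ for all $e\in E(G)$ (no restriction other than non-negativity is imposed on the capacities of the vertical edges). Then for any two distinct vertices $x,y\in V(G)$, $$\mathbf{MF}(x_0,y_0)\ \ge\ \mathbf{MF}(x_0,y_1).$$
   Context: Bunkbed graph: for a finite graph $G=(V,E)$, the bunkbed graph is the Cartesian product $G\times K_2$, where $K_2$ is the complete graph on $\{0,1\}$. Its vertex set is $V(G)\times\{0,1\}$, and $(u,i)$ is written $u_i$. Its edges are the horizontal edges (for each $e\in E(G)$ with endpoints $u,v$ and each $i\in\{0,1\}$, a copy $e_i$ joining $u_i$ and $v_i$) and the vertical edges $u_0u_1$ for $u\in V(G)$. Flows: for a finite unoriented graph $H=(V,E)$, each edge $e$ is considered with both orientations $\overrightarrow{e},\overleftarrow{e}$; an oriented edge $\overrightarrow{e}$ has tail $\overrightarrow{e}^-$ and head $\overrightarrow{e}^+$. A flow is a real-valued function $\theta$ on oriented edges that is antisymmetric: $\theta(\overrightarrow{e})=-\theta(\overleftarrow{e})$. Put $(d^*\theta)(x)=\sum_{\overrightarrow{e}:\overrightarrow{e}^-=x}\theta(\overrightarrow{e})$. For disjoint $A,Z\subset V$, $\theta$ is a flow from $A$ to $Z$ if $(d^*\theta)(x)=0$ for $x\notin A\cup Z$, $(d^*\theta)(x)\ge0$ for $x\in A$, and $(d^*\theta)(x)\le 0$ for $x\in Z$; its strength is $\mathrm{Strength}(\theta)=\sum_{a\in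 A}(d^*\theta)(a)$. Maximum flow: a capacity is a function $c:E\to[0,\infty]$; a flow $\theta$ is admissible if $|\theta(\overrightarrow{e})|\le c(e)$ for all $e\in E$. For disjoint $A,Z\subset V$, $\mathbf{MF}(A,Z)=\sup\{\mathrm{Strength}(\theta):\theta\text{ is an admissible flow from }A\text{ to }Z\}$, and $\mathbf{MF}(s,t)=\mathbf{MF}(\{s\},\{t\})$. *)

theory Defs
  imports Complex_Main "HOL-Library.Extended_Nonnegative_Real"
begin

text \<open>Unoriented graphs. Parallel edges are allowed, since edges are named objects with a set of
  endpoints; so are loops, which are the edges with a single endpoint. A simple graph is the case
  where every edge has two endpoints and \<^term>\<open>ends\<close> is injective on the edges.\<close>

record ('v, 'e) ugraph =
  verts :: "'v set"
  edges :: "'e set"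
  ends :: "'e \<Rightarrow> 'v set"

definition finite_ugraph :: "('v, 'e) ugraph \<Rightarrow> bool" where
  "finite_ugraph H \<longleftrightarrow> finite (verts H) \<and> finite (edges H) \<and>
     (\<forall>e\<in>edges H. \<exists>u\<in>verts H. \<exists>v\<in>verts H. ends H e = {u, v})"

text \<open>The triple \<open>(e, u, v)\<close> is the edge \<open>e\<close> oriented from its tail \<open>u\<close> to its head \<open>v\<close>. The two
  orientations of a loop coincide here, so antisymmetry makes a flow vanish on loops. This does
  not affect \<open>d_star\<close>, in which the two orientations of a loop would cancel.\<close>

definition oriented_edges :: "('v, 'e) ugraph \<Rightarrow> ('e \<times> 'v \<times> 'v) set" where
  "oriented_edges H = {(e, u, v). e \<in> edges H \<and> ends H e = {u, v}}"

definition tail :: "'e \<times> 'v \<times> 'v \<Rightarrow> 'v" where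
  "tail = (\<lambda>(e, u, v). u)"

definition flow :: "('v, 'e) ugraph \<Rightarrow> ('e \<times> 'v \<times> 'v \<Rightarrow> real) \<Rightarrow> bool" where
  "flow H \<theta> \<longleftrightarrow> (\<forall>(e, u, v)\<in>oriented_edges H. \<theta> (e, u, v) = - \<theta> (e, v, u))"

definition d_star :: "('v, 'e) ugraph \<Rightarrow> ('e \<times> 'v \<times> 'v \<Rightarrow> real) \<Rightarrow> 'v \<Rightarrow> real" where
  "d_star H \<theta> x = (\<Sum>a | a \<in> oriented_edges H \<and> tail a = x. \<theta> a)"

definition flow_from_to ::
    "('v, 'e) ugraph \<Rightarrow> 'v set \<Rightarrow> 'v set \<Rightarrow> ('e \<times> 'v \<times> 'v \<Rightarrow> real) \<Rightarrow> bool" where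
  "flow_from_to H A Z \<theta> \<longleftrightarrow> flow H \<theta> \<and>
     (\<forall>x\<in>verts H - (A \<union> Z). d_star H \<theta> x = 0) \<and>
     (\<forall>x\<in>A. d_star H \<theta> x \<ge> 0) \<and>
     (\<forall>x\<in>Z. d_star H \<theta> x \<le> 0)"

definition strength :: "('v, 'e) ugraph \<Rightarrow> 'v set \<Rightarrow> ('e \<times> 'v \<times> 'v \<Rightarrow> real) \<Rightarrow> real" where
  "strength H A \<theta> = (\<Sum>a\<in>A. d_star H \<theta> a)"

definition admissible ::
    "('v, 'e) ugraph \<Rightarrow> ('e \<Rightarrow> ennreal) \<Rightarrow> ('e \<times> 'v \<times> 'v \<Rightarrow> real) \<Rightarrow> bool" where
  "admissible H c \<theta> \<longleftrightarrow> (\<forall>(e, u, v)\<in>oriented_edges H. ennreal \<bar>\<theta> (e, u, v)\<bar> \<le> c e)"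

text \<open>The supremum is taken in the extended reals: it may be infinite. Meaningful for disjoint
  sets \<open>A\<close>, \<open>Z\<close> of vertices.\<close>

definition max_flow ::
    "('v, 'e) ugraph \<Rightarrow> ('e \<Rightarrow> ennreal) \<Rightarrow> 'v set \<Rightarrow> 'v set \<Rightarrow> ereal" where
  "max_flow H c A Z =
     Sup {ereal (strength H A \<theta>) | \<theta>. flow_from_to H A Z \<theta> \<and> admissible H c \<theta>}"

abbreviation MF :: "('v, 'e) ugraph \<Rightarrow> ('e \<Rightarrow> ennreal) \<Rightarrow> 'v \<Rightarrow> 'v \<Rightarrow> ereal" where
  "MF H c s t \<equiv> max_flow H c {s} {t}"

text \<open>In the bunkbed graph, the vertex \<open>u\<^sub>i\<close> is \<open>(u, i)\<close>, the edge \<open>e\<^sub>i\<close> is \<open>Horizontal e i\<close>, and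
  \<open>Vertical u\<close> joins \<open>u\<^sub>0\<close> and \<open>u\<^sub>1\<close>.\<close>

datatype ('v, 'e) bunkbed_edge = Horizontal 'e nat | Vertical 'v

definition bunkbed :: "('v, 'e) ugraph \<Rightarrow> ('v \<times> nat, ('v, 'e) bunkbed_edge) ugraph" where
  "bunkbed G = \<lparr>
     verts = verts G \<times> {0, 1},
     edges = {Horizontal e i | e i. e \<in> edges G \<and> i \<in> {0, 1}} \<union> {Vertical u | u. u \<in> verts G},
     ends = (\<lambda>b. case b of Horizontal e i \<Rightarrow> (\<lambda>u. (u, i)) ` ends G e
                         | Vertical u \<Rightarrow> {(u, 0), (u, 1)})\<rparr>"

definition reflection_symmetric ::
    "('v, 'e) ugraph \<Rightarrow> (('v, 'e) bunkbed_edge \<Rightarrow> ennreal) \<Rightarrow> bool" where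
  "reflection_symmetric G c \<longleftrightarrow> (\<forall>e\<in>edges G. c (Horizontal e 0) = c (Horizontal e 1))"

lemma finite_ugraph_bunkbed:
  assumes "finite_ugraph G"
  shows "finite_ugraph (bunkbed G)"
proof -
  have "{Horizontal e i | e i. e \<in> edges G \<and> i \<in> {0, 1}} =
      (\<lambda>(e, i). Horizontal e i :: ('a, 'b) bunkbed_edge) ` (edges G \<times> {0, 1})"
    by auto
  moreover have "{Vertical u | u. u \<in> verts G} = (Vertical :: _ \<Rightarrow> ('a, 'b) bunkbed_edge) ` verts G"
    by auto
  ultimately have "finite (edges (bunkbed G))"
    using assms by (simp add: bunkbed_def finite_ugraph_def)
  moreover have "\<exists>u\<in>verts (bunkbed G). \<exists>v\<in>verts (bunkbed G). ends (bunkbed G) b = {u, v}"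
    if "b \<in> edges (bunkbed G)" for b
  proof (cases b)
    case (Horizontal e i)
    with that have "e \<in> edges G" "i \<in> {0, 1}"
      by (auto simp: bunkbed_def)
    moreover from this assms obtain u v where "u \<in> verts G" "v \<in> verts G" "ends G e = {u, v}"
      unfolding finite_ugraph_def by blast
    ultimately show ?thesis
      using Horizontal by (intro bexI[of _ "(u, i)"] bexI[of _ "(v, i)"]) (auto simp: bunkbed_def)
  next
    case (Vertical u)
    with that show ?thesis
      by (intro bexI[of _ "(u, 0)"] bexI[of _ "(u, 1)"]) (auto simp: bunkbed_def)
  qed
  ultimately show ?thesis
    using assms by (simp add: finite_ugraph_def) (simp add: bunkbed_def)
qed

end

theory Submission
  imports Defs "HOL-Analysis.Function_Topology"
begin

text \<open>By max-flow min-cut it is enough to compare cuts, and capacities may be truncated so that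
  they are finite. Let the set with levels \<open>A\<close> and \<open>B\<close> contain \<open>x\<^sub>0\<close> but not \<open>y\<^sub>0\<close>. The set
  with levels \<open>A \<union> B\<close> and \<open>A \<inter> B\<close> contains \<open>x\<^sub>0\<close> but not \<open>y\<^sub>1\<close>, and its cut is not more
  expensive: for the horizontal edges this is submodularity, and the vertical edges in the cut are
  the same, since \<open>A\<close> and \<open>B\<close> differ in the same vertices as \<open>A \<union> B\<close> and \<open>A \<inter> B\<close>.\<close>

section \<open>Cuts and the oriented edges leaving them\<close>

definition cut_edges :: "('v, 'e) ugraph \<Rightarrow> 'v set \<Rightarrow> 'e set" where
  "cut_edges H S = {e \<in> edges H. ends H e \<inter> S \<noteq> {} \<and> \<not> ends H e \<subseteq> S}"

definition crossing :: "('v, 'e) ugraph \<Rightarrow> 'v set \<Rightarrow> ('e \<times> 'v \<times> 'v) set" where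
  "crossing H S = {(e, u, v) \<in> oriented_edges H. u \<in> S \<and> v \<notin> S}"

lemma ends_doubleton:
  assumes "finite_ugraph H" "e \<in> edges H"
  obtains u v where "ends H e = {u, v}"
  using assms unfolding finite_ugraph_def by blast

lemma oriented_edges_subset:
  "finite_ugraph H \<Longrightarrow> oriented_edges H \<subseteq> edges H \<times> verts H \<times> verts H"
  by (fastforce simp: oriented_edges_def finite_ugraph_def doubleton_eq_iff)

lemma finite_oriented_edges: "finite_ugraph H \<Longrightarrow> finite (oriented_edges H)"
  by (rule finite_subset[OF oriented_edges_subset]) (simp_all add: finite_ugraph_def)

lemma oriented_edges_swap: "(e, u, v) \<in> oriented_edges H \<longleftrightarrow> (e, v, u) \<in> oriented_edges H"
  by (auto simp: oriented_edges_def insert_commute)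

lemma finite_cut_edges: "finite_ugraph H \<Longrightarrow> finite (cut_edges H S)"
  by (simp add: cut_edges_def finite_ugraph_def)

lemma crossing_subset: "crossing H S \<subseteq> oriented_edges H"
  by (auto simp: crossing_def)

text \<open>A cut edge has one endpoint on each side, so exactly one of its orientations leaves
  \<open>S\<close>. This links sums of flow over oriented edges to sums of capacity over
  edges.\<close>

lemma bij_betw_crossing_cut:
  assumes "finite_ugraph H"
  shows "bij_betw fst (crossing H S) (cut_edges H S)"
proof (rule bij_betwI')
  fix a b assume "a \<in> crossing H S" "b \<in> crossing H S"
  then show "(fst a = fst b) = (a = b)"
    by (auto simp: crossing_def oriented_edges_def doubleton_eq_iff)
next
  fix a assume "a \<in> crossing H S"
  then show "fst a \<in> cut_edges H S"
    by (auto simp: crossing_def oriented_edges_def cut_edges_def)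
next
  fix e assume e: "e \<in> cut_edges H S"
  then obtain u v where uv: "ends H e = {u, v}"
    using ends_doubleton[OF assms] unfolding cut_edges_def by blast
  with e have "(e, u, v) \<in> crossing H S \<or> (e, v, u) \<in> crossing H S"
    by (auto simp: cut_edges_def crossing_def oriented_edges_def)
  then show "\<exists>a\<in>crossing H S. e = fst a"
    by force
qed

lemma sum_crossing:
  assumes "finite_ugraph H"
  shows "(\<Sum>a\<in>crossing H S. f (fst a)) = (\<Sum>e\<in>cut_edges H S. f e)"
  by (rule sum.reindex_bij_betw[OF bij_betw_crossing_cut[OF assms]])

section \<open>Net flow across a cut and weak duality\<close>

text \<open>Reversing orientations permutes the oriented edges inside \<open>S\<close> and negates
  \<open>\<theta>\<close>, so the sum equals its own negative.\<close>

lemma sum_antisym_eq_0: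
  assumes fin: "finite_ugraph H" and "flow H \<theta>"
  shows "(\<Sum>a | a \<in> oriented_edges H \<and> fst (snd a) \<in> S \<and> snd (snd a) \<in> S. \<theta> a) = (0::real)"
    (is "sum \<theta> ?I = 0")
proof -
  let ?sw = "\<lambda>(e, u, v). (e, v, u)"
  have "sum \<theta> ?I = (\<Sum>a\<in>?I. \<theta> (?sw a))"
    by (rule sum.reindex_bij_witness[of _ ?sw ?sw])
      (auto simp: oriented_edges_swap)
  also have "\<dots> = (\<Sum>a\<in>?I. - \<theta> a)"
    using \<open>flow H \<theta>\<close> by (intro sum.cong refl) (fastforce simp: flow_def oriented_edges_swap)
  also have "\<dots> = - sum \<theta> ?I"
    by (rule sum_negf)
  finally show ?thesis by simp
qed

text \<open>Discrete divergence theorem: an oriented edge with tail in \<open>S\<close> either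
  leaves \<open>S\<close> or stays inside, and the flow on the latter cancels.\<close>

lemma sum_d_star:
  assumes fin: "finite_ugraph H" and fl: "flow H \<theta>" and S: "S \<subseteq> verts H"
  shows "(\<Sum>x\<in>S. d_star H \<theta> x) = (\<Sum>a\<in>crossing H S. \<theta> a)"
proof -
  let ?O = "oriented_edges H"
  let ?I = "{a \<in> ?O. fst (snd a) \<in> S \<and> snd (snd a) \<in> S}"
  let ?T = "{a \<in> ?O. tail a \<in> S}"
  have finO: "finite ?O" using fin by (rule finite_oriented_edges)
  have finS: "finite S" using fin S by (auto simp: finite_ugraph_def intro: finite_subset)
  have "(\<Sum>x\<in>S. d_star H \<theta> x) = (\<Sum>x\<in>S. \<Sum>a | a \<in> ?T \<and> tail a = x. \<theta> a)"
    unfolding d_star_def by (intro sum.cong refl) auto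
  also have "\<dots> = sum \<theta> ?T"
    using finS finO by (intro sum.group) auto
  also have "?T = crossing H S \<union> ?I"
    by (auto simp: crossing_def tail_def)
  also have "sum \<theta> \<dots> = sum \<theta> (crossing H S) + sum \<theta> ?I"
    using finO by (intro sum.union_disjoint) (auto simp: crossing_def intro: finite_subset[OF _ finO])
  also have "sum \<theta> ?I = 0"
    using fin fl by (rule sum_antisym_eq_0)
  finally show ?thesis by simp
qed

lemma d_star_eq_sum_crossing:
  assumes "finite_ugraph H" "flow H \<theta>" "\<forall>x\<in>verts H - {s, t}. d_star H \<theta> x = 0"
    and "S \<subseteq> verts H" "s \<in> S" "t \<notin> S"
  shows "d_star H \<theta> s = (\<Sum>a\<in>crossing H S. \<theta> a)"
proof -
  have "finite S"
    using assms by (auto simp: finite_ugraph_def intro: finite_subset)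
  then have "d_star H \<theta> s = (\<Sum>x\<in>{s}. d_star H \<theta> x)"
    by simp
  also have "\<dots> = (\<Sum>x\<in>S. d_star H \<theta> x)"
    using assms \<open>finite S\<close> by (intro sum.mono_neutral_left) auto
  finally show ?thesis
    using sum_d_star assms by metis
qed

lemma admissible_real_iff:
  "(\<And>e. 0 \<le> k e) \<Longrightarrow>
    admissible H (\<lambda>e. ennreal (k e)) \<theta> \<longleftrightarrow> (\<forall>a\<in>oriented_edges H. \<bar>\<theta> a\<bar> \<le> k (fst a))"
  by (auto simp: admissible_def)

lemma strength_le_cut:
  fixes k :: "'e \<Rightarrow> real" and H :: "('v, 'e) ugraph"
  assumes fin: "finite_ugraph H" and k: "\<And>e. 0 \<le> k e"
    and "flow_from_to H {s} {t} \<theta>" and adm: "admissible H (\<lambda>e. ennreal (k e)) \<theta>"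
    and "S \<subseteq> verts H" "s \<in> S" "t \<notin> S"
  shows "strength H {s} \<theta> \<le> (\<Sum>e\<in>cut_edges H S. k e)"
proof -
  have "d_star H \<theta> s = (\<Sum>a\<in>crossing H S. \<theta> a)"
    using assms by (intro d_star_eq_sum_crossing[where t = t]) (auto simp: flow_from_to_def)
  then have "strength H {s} \<theta> = (\<Sum>a\<in>crossing H S. \<theta> a)"
    by (simp add: strength_def)
  also have "\<dots> \<le> (\<Sum>a\<in>crossing H S. k (fst a))"
    using adm crossing_subset[of H S]
    by (intro sum_mono) (fastforce simp: admissible_real_iff[OF k])
  finally show ?thesis
    using sum_crossing[OF fin, of k] by simp
qed

section \<open>Existence of a maximal flow by compactness\<close>

text \<open>Antisymmetry and the bound range over all triples, not only oriented edges, so that the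
  feasible functions lie in a compact box. The sign conditions at \<open>s\<close> and
  \<open>t\<close> are recovered later, for a maximizer.\<close>

definition feasible ::
    "('v, 'e) ugraph \<Rightarrow> ('e \<Rightarrow> real) \<Rightarrow> 'v \<Rightarrow> 'v \<Rightarrow> ('e \<times> 'v \<times> 'v \<Rightarrow> real) \<Rightarrow> bool" where
  "feasible H k s t \<theta> \<longleftrightarrow> (\<forall>e u v. \<theta> (e, u, v) = - \<theta> (e, v, u)) \<and>
     (\<forall>a. \<bar>\<theta> a\<bar> \<le> k (fst a)) \<and> (\<forall>x\<in>verts H - {s, t}. d_star H \<theta> x = 0)"

lemma d_star_add: "d_star H (\<lambda>a. \<theta> a + \<phi> a) x = d_star H \<theta> x + d_star H \<phi> x"
  by (simp add: d_star_def sum.distrib)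

lemma d_star_scale: "d_star H (\<lambda>a. r * \<theta> a) x = r * d_star H \<theta> x"
  by (simp add: d_star_def sum_distrib_left)

lemma continuous_on_d_star: "continuous_on X (\<lambda>\<theta>. d_star H \<theta> x)"
  unfolding d_star_def
  by (intro continuous_on_sum continuous_on_subset[OF continuous_on_product_coordinates]) auto

text \<open>The box is compact by Tychonoff, and the remaining conditions are equations between
  continuous functions, hence closed.\<close>

lemma compact_feasible:
  fixes k :: "'e \<Rightarrow> real" and H :: "('v, 'e) ugraph"
  shows "compact {\<theta>. feasible H k s t \<theta>}"
proof -
  let ?B = "PiE UNIV (\<lambda>a :: 'e \<times> 'v \<times> 'v. {- k (fst a)..k (fst a)})"
  have "compactin (product_topology (\<lambda>_. euclidean) UNIV) ?B"
    by (simp add: compactin_PiE)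
  then have "compact ?B"
    by (simp add: euclidean_product_topology)
  moreover have "closed {\<theta> :: 'e \<times> 'v \<times> 'v \<Rightarrow> real. \<forall>e u v. \<theta> (e, u, v) = - \<theta> (e, v, u)}"
    by (intro closed_Collect_all closed_Collect_eq continuous_intros continuous_on_product_coordinates)
  moreover have "closed {\<theta>. \<forall>x\<in>verts H - {s, t}. d_star H \<theta> x = 0}"
    unfolding Ball_def
    by (intro closed_Collect_all closed_Collect_imp open_Collect_const closed_Collect_eq
        continuous_on_d_star continuous_intros)
  moreover have "\<bar>r\<bar> \<le> q \<longleftrightarrow> r \<in> {- q..q}" for r q :: real
    by auto
  then have "{\<theta>. feasible H k s t \<theta>} = ?B \<inter>
      {\<theta>. \<forall>e u v. \<theta> (e, u, v) = - \<theta> (e, v, u)} \<inter> {\<theta>. \<forall>x\<in>verts H - {s, t}. d_star H \<theta> x = 0}"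
    unfolding feasible_def by (simp only: PiE_UNIV_domain) blast
  ultimately show ?thesis
    by (simp add: compact_Int_closed)
qed

section \<open>Augmentation and max-flow min-cut\<close>

text \<open>The minimal cut consists of the vertices to which a maximal \<open>\<theta>\<close> can be
  augmented. Convexity replaces augmenting paths: before pushing an amount through one more
  edge, the augmentation \<open>\<phi>\<close> is scaled down so far that the edge has room.\<close>

definition augmentable ::
    "('v, 'e) ugraph \<Rightarrow> ('e \<Rightarrow> real) \<Rightarrow> 'v \<Rightarrow> ('e \<times> 'v \<times> 'v \<Rightarrow> real) \<Rightarrow> 'v \<Rightarrow> bool" where
  "augmentable H k s \<theta> v \<longleftrightarrow> (\<exists>\<epsilon>>0. \<exists>\<phi>. (\<forall>e u v. \<phi> (e, u, v) = - \<phi> (e, v, u)) \<and>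
     (\<forall>a. \<bar>\<theta> a + \<phi> a\<bar> \<le> k (fst a)) \<and>
     (\<forall>x. d_star H \<phi> x = \<epsilon> * (of_bool (x = s) - of_bool (x = v))))"

text \<open>As a difference of indicators this is zero on a loop, whose two orientations
  coincide.\<close>

definition unit_flow :: "'e \<times> 'v \<times> 'v \<Rightarrow> 'e \<times> 'v \<times> 'v \<Rightarrow> real" where
  "unit_flow = (\<lambda>(e, u, v) b. of_bool (b = (e, u, v)) - of_bool (b = (e, v, u)))"

lemma unit_flow_swap: "unit_flow a (e, u, v) = - unit_flow a (e, v, u)"
  by (cases a) (simp only: unit_flow_def prod.case prod.inject conj_ac minus_diff_eq)

lemma d_star_unit_flow:
  assumes fin: "finite_ugraph H" and a: "(e, u, v) \<in> oriented_edges H"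
  shows "d_star H (unit_flow (e, u, v)) x = of_bool (x = u) - of_bool (x = v)"
proof -
  have *: "(\<Sum>a | a \<in> oriented_edges H \<and> tail a = x. of_bool (a = b)) = (of_bool (x = tail b) :: real)"
    if "b \<in> oriented_edges H" for b
  proof -
    have "(\<Sum>a | a \<in> oriented_edges H \<and> tail a = x. of_bool (a = b)) =
        (\<Sum>a\<in>{a \<in> oriented_edges H. tail a = x}. if a = b then 1 else 0 :: real)"
      by (intro sum.cong) auto
    also have "\<dots> = of_bool (x = tail b)"
      using that finite_oriented_edges[OF fin] by (subst sum.delta) auto
    finally show ?thesis .
  qed
  have a': "(e, v, u) \<in> oriented_edges H"
    using a oriented_edges_swap by metis
  have "d_star H (unit_flow (e, u, v)) x =
      (\<Sum>a | a \<in> oriented_edges H \<and> tail a = x. of_bool (a = (e, u, v))) -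
      (\<Sum>a | a \<in> oriented_edges H \<and> tail a = x. of_bool (a = (e, v, u)))"
    by (simp add: d_star_def unit_flow_def sum_subtractf)
  also have "\<dots> = of_bool (x = u) - of_bool (x = v)"
    unfolding *[OF a] *[OF a'] by (simp add: tail_def)
  finally show ?thesis .
qed

text \<open>One search step in the residual graph. The assumption \<open>room\<close> says that the
  residual capacity from \<open>u\<close> to \<open>v\<close> is positive; this includes undoing
  flow that runs from \<open>v\<close> to \<open>u\<close>.\<close>

lemma augmentable_step:
  fixes \<theta> :: "'e \<times> 'v \<times> 'v \<Rightarrow> real"
  assumes fin: "finite_ugraph H" and a: "(e, u, v) \<in> oriented_edges H" and "u \<noteq> v"
    and anti: "\<And>e u v. \<theta> (e, u, v) = - \<theta> (e, v, u)" and bound: "\<And>a. \<bar>\<theta> a\<bar> \<le> k (fst a)"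
    and room: "\<theta> (e, u, v) < k e" and "augmentable H k s \<theta> u"
  shows "augmentable H k s \<theta> v"
proof -
  obtain \<epsilon> \<phi> where eps: "\<epsilon> > 0" and anti': "\<And>e u v. \<phi> (e, u, v) = - \<phi> (e, v, u)"
    and bound': "\<And>a. \<bar>\<theta> a + \<phi> a\<bar> \<le> k (fst a)"
    and d: "\<And>x. d_star H \<phi> x = \<epsilon> * (of_bool (x = s) - of_bool (x = u))"
    using \<open>augmentable H k s \<theta> u\<close> unfolding augmentable_def by blast
  \<comment> \<open>The bound 1 keeps \<open>\<theta> + r * \<phi>\<close> on the segment from
    \<open>\<theta>\<close> to \<open>\<theta> + \<phi>\<close>. The quotient leaves room on
    \<open>e\<close> for the scaled \<open>\<phi>\<close> and a further
    \<open>r * \<epsilon>\<close>; the summand \<open>\<epsilon>\<close> makes the denominator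
    positive.\<close>
  define r where "r = min 1 ((k e - \<theta> (e, u, v)) / (\<bar>\<phi> (e, u, v)\<bar> + \<epsilon>))"
  have r: "0 < r" "r \<le> 1"
    using eps room by (auto simp: r_def)
  have "r \<le> (k e - \<theta> (e, u, v)) / (\<bar>\<phi> (e, u, v)\<bar> + \<epsilon>)"
    by (simp add: r_def)
  then have "r * (\<bar>\<phi> (e, u, v)\<bar> + \<epsilon>) \<le> k e - \<theta> (e, u, v)"
    using eps by (simp add: pos_le_divide_eq add_nonneg_pos)
  moreover have "r * (\<phi> (e, u, v) + \<epsilon>) \<le> r * (\<bar>\<phi> (e, u, v)\<bar> + \<epsilon>)"
    using r by (intro mult_left_mono) auto
  ultimately have upper: "\<theta> (e, u, v) + r * \<phi> (e, u, v) + r * \<epsilon> \<le> k e"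
    by (simp add: algebra_simps)
  have convex: "\<bar>\<theta> b + r * \<phi> b\<bar> \<le> k (fst b)" for b
  proof -
    have "\<theta> b + r * \<phi> b = (1 - r) * \<theta> b + r * (\<theta> b + \<phi> b)"
      by (simp add: algebra_simps)
    also have "\<bar>\<dots>\<bar> \<le> (1 - r) * \<bar>\<theta> b\<bar> + r * \<bar>\<theta> b + \<phi> b\<bar>"
      using r abs_triangle_ineq[of "(1 - r) * \<theta> b" "r * (\<theta> b + \<phi> b)"] by (simp add: abs_mult)
    also have "\<dots> \<le> (1 - r) * k (fst b) + r * k (fst b)"
      using r bound bound' by (intro add_mono mult_left_mono) auto
    finally show ?thesis by (simp add: algebra_simps)
  qed
  \<comment> \<open>The scaled \<open>\<phi>\<close> brings the amount \<open>r * \<epsilon>\<close>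
    from \<open>s\<close> to \<open>u\<close>, and the unit flow carries it on to \<open>v\<close>,
    so the divergences at \<open>u\<close> cancel.\<close>
  define \<psi> where "\<psi> = (\<lambda>b. r * \<phi> b + r * \<epsilon> * unit_flow (e, u, v) b)"
  have re: "0 < r * \<epsilon>" using r eps by simp
  have "\<psi> (e', u', v') = - \<psi> (e', v', u')" for e' u' v'
    unfolding \<psi>_def anti'[of e' u' v'] unit_flow_swap[of _ e' u' v'] by (simp add: algebra_simps)
  moreover have "\<bar>\<theta> b + \<psi> b\<bar> \<le> k (fst b)" for b
  proof -
    \<comment> \<open>Along \<open>(e, u, v)\<close> the added amount is positive, so
      \<open>convex\<close> gives the lower bound and \<open>upper\<close> the upper one. The
      reverse orientation follows by antisymmetry, and elsewhere the unit flow vanishes.\<close>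
    consider "b = (e, u, v)" | "b = (e, v, u)" | "b \<noteq> (e, u, v)" "b \<noteq> (e, v, u)"
      by blast
    then show ?thesis
    proof cases
      case 1
      have "\<psi> b = r * \<phi> b + r * \<epsilon>"
        using 1 \<open>u \<noteq> v\<close> by (simp add: \<psi>_def unit_flow_def)
      then show ?thesis
        using 1 convex[of b] upper re by (simp add: abs_le_iff)
    next
      case 2
      have "\<psi> b = r * \<phi> b - r * \<epsilon>"
        using 2 \<open>u \<noteq> v\<close> by (simp add: \<psi>_def unit_flow_def)
      then show ?thesis
        using 2 convex[of b] upper re anti[of e u v] anti'[of e u v] by (simp add: abs_le_iff)
    next
      case 3
      then show ?thesis
        using convex[of b] by (simp add: \<psi>_def unit_flow_def)
    qed
  qed
  moreover have "d_star H \<psi> x = r * \<epsilon> * (of_bool (x = s) - of_bool (x = v))" for x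
    unfolding \<psi>_def d_star_add d_star_scale d d_star_unit_flow[OF fin a]
    by (simp add: algebra_simps)
  ultimately show ?thesis
    unfolding augmentable_def using re by blast
qed

text \<open>With finite capacities a maximizer \<open>\<theta>\<close> exists. The vertices to which
  it can be augmented exclude \<open>t\<close>, and every edge leaving them is saturated.\<close>

theorem max_flow_min_cut:
  fixes k :: "'e \<Rightarrow> real" and H :: "('v, 'e) ugraph"
  assumes fin: "finite_ugraph H" and k: "\<And>e. 0 \<le> k e"
    and s: "s \<in> verts H" and t: "t \<in> verts H" and "s \<noteq> t"
  obtains \<theta> S where "flow_from_to H {s} {t} \<theta>" "admissible H (\<lambda>e. ennreal (k e)) \<theta>"
    "S \<subseteq> verts H" "s \<in> S" "t \<notin> S" "strength H {s} \<theta> = (\<Sum>e\<in>cut_edges H S. k e)"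
proof -
  have zero: "feasible H k s t (\<lambda>_. 0)"
    using k by (simp add: feasible_def d_star_def)
  then obtain \<theta> where feas: "feasible H k s t \<theta>"
    and max: "\<And>\<phi>. feasible H k s t \<phi> \<Longrightarrow> d_star H \<phi> s \<le> d_star H \<theta> s"
    using continuous_attains_sup[OF compact_feasible _ continuous_on_d_star, of H k s t H s] by auto
  from feas have anti: "\<And>e u v. \<theta> (e, u, v) = - \<theta> (e, v, u)"
    and bound: "\<And>a. \<bar>\<theta> a\<bar> \<le> k (fst a)" and cons: "\<forall>x\<in>verts H - {s, t}. d_star H \<theta> x = 0"
    unfolding feasible_def by blast+
  have fl: "flow H \<theta>"
    unfolding flow_def using anti by blast
  \<comment> \<open>Maximality against the zero flow gives the sign at \<open>s\<close>. No edge
    leaves the whole vertex set, so all divergences sum to zero, which gives the sign at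
    \<open>t\<close>.\<close>
  have s_nonneg: "0 \<le> d_star H \<theta> s"
    using max[OF zero] by (simp add: d_star_def)
  have "crossing H (verts H) = {}"
    using oriented_edges_subset[OF fin] by (auto simp: crossing_def)
  then have "0 = (\<Sum>x\<in>verts H. d_star H \<theta> x)"
    using sum_d_star[OF fin fl order_refl] by simp
  also have "\<dots> = (\<Sum>x\<in>{s, t}. d_star H \<theta> x)"
    using fin cons s t by (intro sum.mono_neutral_right) (auto simp: finite_ugraph_def)
  finally have "d_star H \<theta> t \<le> 0"
    using s_nonneg \<open>s \<noteq> t\<close> by simp
  with fl cons s_nonneg have 1: "flow_from_to H {s} {t} \<theta>"
    by (simp add: flow_from_to_def)
  have 2: "admissible H (\<lambda>e. ennreal (k e)) \<theta>"
    using bound by (simp add: admissible_real_iff[OF k])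
  define S where "S = {v \<in> verts H. augmentable H k s \<theta> v}"
  \<comment> \<open>The divergence prescribed for the target \<open>s\<close> is zero, so the zero
    function serves with any positive amount.\<close>
  have "augmentable H k s \<theta> s"
    unfolding augmentable_def using bound
    by (intro exI[of _ 1] conjI exI[of _ "\<lambda>_. 0"]) (auto simp: d_star_def)
  with s have sS: "s \<in> S"
    by (simp add: S_def)
  \<comment> \<open>Augmenting to \<open>t\<close> would give a feasible function whose divergence
    at \<open>s\<close> is larger by \<open>\<epsilon>\<close>.\<close>
  have tS: "t \<notin> S"
  proof
    assume "t \<in> S"
    then obtain \<epsilon> \<phi> where eps: "\<epsilon> > 0" and anti': "\<And>e u v. \<phi> (e, u, v) = - \<phi> (e, v, u)"
      and bound': "\<And>a. \<bar>\<theta> a + \<phi> a\<bar> \<le> k (fst a)"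
      and d: "\<And>x. d_star H \<phi> x = \<epsilon> * (of_bool (x = s) - of_bool (x = t))"
      unfolding S_def augmentable_def by blast
    have "(\<theta> (e, u, v) + \<phi> (e, u, v)) = - (\<theta> (e, v, u) + \<phi> (e, v, u))" for e u v
      using anti[of e u v] anti'[of e u v] by simp
    moreover have "\<forall>x\<in>verts H - {s, t}. d_star H (\<lambda>a. \<theta> a + \<phi> a) x = 0"
      using cons by (simp add: d_star_add d)
    ultimately have "feasible H k s t (\<lambda>a. \<theta> a + \<phi> a)"
      using bound' unfolding feasible_def by blast
    from max[OF this] show False
      using eps \<open>s \<noteq> t\<close> by (simp add: d_star_add d)
  qed
  \<comment> \<open>Room on an edge leaving \<open>S\<close> would make its head augmentable too,
    putting it in \<open>S\<close>.\<close>
  have saturated: "\<theta> a = k (fst a)" if cr: "a \<in> crossing H S" for a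
  proof -
    obtain e u v where a: "a = (e, u, v)" "(e, u, v) \<in> oriented_edges H" "u \<in> S" "v \<notin> S"
      using cr by (auto simp: crossing_def)
    have "\<not> \<theta> (e, u, v) < k e"
    proof
      assume "\<theta> (e, u, v) < k e"
      moreover have "augmentable H k s \<theta> u" "u \<noteq> v"
        using a by (auto simp: S_def)
      ultimately have "augmentable H k s \<theta> v"
        using augmentable_step[where \<theta> = \<theta>, OF fin a(2) _ anti bound] by blast
      then show False
        using a oriented_edges_subset[OF fin] by (auto simp: S_def)
    qed
    then show ?thesis
      using a bound[of a] by simp
  qed
  have S: "S \<subseteq> verts H"
    by (auto simp: S_def)
  have "strength H {s} \<theta> = (\<Sum>a\<in>crossing H S. \<theta> a)"
    using d_star_eq_sum_crossing[OF fin fl cons S sS tS] by (simp add: strength_def)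
  also have "\<dots> = (\<Sum>e\<in>cut_edges H S. k e)"
    using sum_crossing[OF fin, of k S] by (simp add: saturated)
  finally show ?thesis
    using that[OF 1 2 S sS tS] by blast
qed

section \<open>Cuts of the bunkbed graph\<close>

definition levels :: "'v set \<Rightarrow> 'v set \<Rightarrow> ('v \<times> nat) set" where
  "levels A B = A \<times> {0} \<union> B \<times> {1}"

text \<open>A horizontal edge is cut exactly when its base edge is cut by the set on its level; a
  vertical edge is cut exactly when its vertex lies in one of \<open>A\<close> and \<open>B\<close>
  but not both.\<close>

lemma sum_cut_bunkbed:
  assumes fin: "finite_ugraph G" and "A \<subseteq> verts G" "B \<subseteq> verts G"
  shows "(\<Sum>b\<in>cut_edges (bunkbed G) (levels A B). k b) =
    (\<Sum>e\<in>cut_edges G A. k (Horizontal e 0)) + (\<Sum>e\<in>cut_edges G B. k (Horizontal e 1)) +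
    (\<Sum>u\<in>(A - B) \<union> (B - A). k (Vertical u) :: real)"
proof -
  let ?h = "\<lambda>i e. Horizontal e i :: ('a, 'b) bunkbed_edge"
  let ?D = "(A - B) \<union> (B - A)"
  have finD: "finite ?D"
    using assms by (auto simp: finite_ugraph_def intro: finite_subset)
  have "cut_edges (bunkbed G) (levels A B) = ?h 0 ` cut_edges G A \<union> ?h 1 ` cut_edges G B \<union> Vertical ` ?D"
    (is "?L = ?R")
  proof (rule set_eqI)
    fix b :: "('a, 'b) bunkbed_edge"
    show "b \<in> ?L \<longleftrightarrow> b \<in> ?R"
      using assms by (cases b) (auto simp: cut_edges_def bunkbed_def levels_def image_iff)
  qed
  then have "sum k ?L = sum k (?h 0 ` cut_edges G A \<union> ?h 1 ` cut_edges G B) + sum k (Vertical ` ?D)"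
    using finD finite_cut_edges[OF fin] by (simp only:) (intro sum.union_disjoint, auto)
  also have "sum k (?h 0 ` cut_edges G A \<union> ?h 1 ` cut_edges G B) =
      sum k (?h 0 ` cut_edges G A) + sum k (?h 1 ` cut_edges G B)"
    using finite_cut_edges[OF fin] by (intro sum.union_disjoint) auto
  finally show ?thesis
    by (simp add: sum.reindex inj_on_def)
qed

text \<open>The inequality holds edge by edge. The two sides count an edge equally often unless it
  joins \<open>A - B\<close> to \<open>B - A\<close>: then it is counted twice on the right and
  never on the left.\<close>

lemma cut_submodular:
  assumes fin: "finite_ugraph G" and w: "\<And>e. e \<in> edges G \<Longrightarrow> 0 \<le> (w e :: real)"
  shows "(\<Sum>e\<in>cut_edges G (A \<union> B). w e) + (\<Sum>e\<in>cut_edges G (A \<inter> B). w e) \<le>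
    (\<Sum>e\<in>cut_edges G A. w e) + (\<Sum>e\<in>cut_edges G B. w e)"
proof -
  have *: "(\<Sum>e\<in>cut_edges G S. w e) = (\<Sum>e\<in>edges G. of_bool (e \<in> cut_edges G S) * w e)" for S
    using fin
    by (intro sum.mono_neutral_cong_left) (auto simp: cut_edges_def finite_ugraph_def)
  have "of_bool (e \<in> cut_edges G (A \<union> B)) * w e + of_bool (e \<in> cut_edges G (A \<inter> B)) * w e \<le>
      of_bool (e \<in> cut_edges G A) * w e + of_bool (e \<in> cut_edges G B) * w e" if "e \<in> edges G" for e
  proof -
    obtain u v where "ends G e = {u, v}"
      using ends_doubleton[OF fin \<open>e \<in> edges G\<close>] .
    with that w[OF that] show ?thesis
      by (auto simp: cut_edges_def)
  qed
  then show ?thesis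
    unfolding * sum.distrib[symmetric] by (rule sum_mono)
qed

lemma ex_separating_cut:
  fixes k :: "('v, 'e) bunkbed_edge \<Rightarrow> real"
  assumes fin: "finite_ugraph G" and k: "\<And>b. 0 \<le> k b"
    and sym: "\<And>e. e \<in> edges G \<Longrightarrow> k (Horizontal e 0) = k (Horizontal e 1)"
    and S: "S \<subseteq> verts (bunkbed G)" and x: "(x, 0) \<in> S" and y: "(y, 0) \<notin> S"
  obtains T where "T \<subseteq> verts (bunkbed G)" "(x, 0) \<in> T" "(y, 1) \<notin> T"
    "(\<Sum>b\<in>cut_edges (bunkbed G) T. k b) \<le> (\<Sum>b\<in>cut_edges (bunkbed G) S. k b)"
proof -
  define A where "A = {u. (u, 0) \<in> S}"
  define B where "B = {u. (u, 1) \<in> S}"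
  have AB: "A \<subseteq> verts G" "B \<subseteq> verts G"
    using S by (auto simp: A_def B_def bunkbed_def)
  have S_eq: "S = levels A B"
    using S by (auto simp: A_def B_def bunkbed_def levels_def)
  \<comment> \<open>Reflection symmetry gives both levels the same edge weights, so submodularity on
    \<open>G\<close> applies to sets from different levels.\<close>
  have sym': "(\<Sum>e\<in>cut_edges G C. k (Horizontal e 1)) = (\<Sum>e\<in>cut_edges G C. k (Horizontal e 0))" for C
    by (intro sum.cong) (auto simp: cut_edges_def sym)
  have D: "(A \<union> B - A \<inter> B) \<union> (A \<inter> B - (A \<union> B)) = (A - B) \<union> (B - A)"
    by auto
  have "(\<Sum>b\<in>cut_edges (bunkbed G) (levels (A \<union> B) (A \<inter> B)). k b) =
      (\<Sum>e\<in>cut_edges G (A \<union> B). k (Horizontal e 0)) + (\<Sum>e\<in>cut_edges G (A \<inter> B). k (Horizontal e 0)) +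
      (\<Sum>u\<in>(A - B) \<union> (B - A). k (Vertical u))"
    using AB by (subst sum_cut_bunkbed[OF fin]) (auto simp only: sym' D)
  also have "\<dots> \<le> (\<Sum>e\<in>cut_edges G A. k (Horizontal e 0)) + (\<Sum>e\<in>cut_edges G B. k (Horizontal e 0)) +
      (\<Sum>u\<in>(A - B) \<union> (B - A). k (Vertical u))"
    using cut_submodular[OF fin, of "\<lambda>e. k (Horizontal e 0)"] k by simp
  also have "\<dots> = (\<Sum>b\<in>cut_edges (bunkbed G) S. k b)"
    unfolding S_eq sum_cut_bunkbed[OF fin AB] sym' ..
  \<comment> \<open>From \<open>(y, 0) \<notin> S\<close> it follows that \<open>y\<close> is
    outside \<open>A\<close>, hence outside \<open>A \<inter> B\<close>, the upper level of the new
    cut.\<close>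
  finally show ?thesis
    using that[of "levels (A \<union> B) (A \<inter> B)"] AB x y
    by (auto simp: levels_def A_def bunkbed_def)
qed

section \<open>Comparison of the two maximum flows\<close>

theorem theorem1p4:
  fixes G :: "('v, 'e) ugraph"
    and c :: "('v, 'e) bunkbed_edge \<Rightarrow> ennreal"
    and x y :: 'v
  assumes "finite_ugraph G"
    and "reflection_symmetric G c"
    and "x \<in> verts G" and "y \<in> verts G" and "x \<noteq> y"
  shows "MF (bunkbed G) c (x, 0) (y, 0) \<ge> MF (bunkbed G) c (x, 0) (y, 1)"
proof -
  let ?H = "bunkbed G"
  have fin: "finite_ugraph ?H"
    using assms(1) by (rule finite_ugraph_bunkbed)
  have xy: "(x, 0) \<in> verts ?H" "(y, 0) \<in> verts ?H" "(x, 0) \<noteq> (y, 0 :: nat)"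
    using assms by (auto simp: bunkbed_def)
  have "ereal (strength ?H {(x, 0)} \<theta>) \<le> MF ?H c (x, 0) (y, 0)"
    if fl: "flow_from_to ?H {(x, 0)} {(y, 1)} \<theta>" and adm: "admissible ?H c \<theta>" for \<theta>
  proof -
    \<comment> \<open>\<open>M\<close> bounds \<open>\<theta>\<close> on every oriented edge, so
      truncating at \<open>M\<close> makes all capacities finite and keeps \<open>\<theta>\<close>
      admissible. Truncation only lowers capacities, so the flow \<open>\<phi>\<close> found below
      is admissible for \<open>c\<close> as well.\<close>
    define M where "M = (\<Sum>a\<in>oriented_edges ?H. \<bar>\<theta> a\<bar>)"
    define k where "k b = enn2real (min (c b) (ennreal M))" for b
    have k_eq: "ennreal (k b) = min (c b) (ennreal M)" for b
      unfolding k_def by (rule ennreal_enn2real) (simp add: min_less_iff_disj)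
    have k: "0 \<le> k b" for b
      by (simp add: k_def)
    have sym: "k (Horizontal e 0) = k (Horizontal e 1)" if "e \<in> edges G" for e
      using assms(2) that by (simp add: k_def reflection_symmetric_def)
    have "\<bar>\<theta> a\<bar> \<le> M" if "a \<in> oriented_edges ?H" for a
      unfolding M_def using that finite_oriented_edges[OF fin] by (intro member_le_sum) auto
    with adm have adm': "admissible ?H (\<lambda>b. ennreal (k b)) \<theta>"
      by (fastforce simp: admissible_def k_eq intro: ennreal_leI)
    obtain \<phi> S where fl': "flow_from_to ?H {(x, 0)} {(y, 0)} \<phi>"
      and adm_\<phi>: "admissible ?H (\<lambda>b. ennreal (k b)) \<phi>"
      and S: "S \<subseteq> verts ?H" "(x, 0) \<in> S" "(y, 0) \<notin> S"
      and str: "strength ?H {(x, 0)} \<phi> = (\<Sum>b\<in>cut_edges ?H S. k b)"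
      using max_flow_min_cut[where k = k, OF fin k xy] by blast
    obtain T where T: "T \<subseteq> verts ?H" "(x, 0) \<in> T" "(y, 1) \<notin> T"
      and le: "(\<Sum>b\<in>cut_edges ?H T. k b) \<le> (\<Sum>b\<in>cut_edges ?H S. k b)"
      using ex_separating_cut[where k = k, OF assms(1) k sym S] by blast
    \<comment> \<open>Weak duality bounds \<open>\<theta>\<close> by the cut \<open>T\<close>, which
      costs at most as much as \<open>S\<close>, and the cost of \<open>S\<close> is the strength of
      \<open>\<phi>\<close>.\<close>
    have "strength ?H {(x, 0)} \<theta> \<le> strength ?H {(x, 0)} \<phi>"
      using strength_le_cut[where k = k, OF fin k fl adm' T] le str by simp
    moreover have "admissible ?H c \<phi>"
      using adm_\<phi> by (fastforce simp: admissible_def k_eq)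
    with fl' have "ereal (strength ?H {(x, 0)} \<phi>) \<le> MF ?H c (x, 0) (y, 0)"
      unfolding max_flow_def by (intro Sup_upper) auto
    ultimately show ?thesis
      by (meson ereal_less_eq(3) order_trans)
  qed
  then show ?thesis
    unfolding max_flow_def[of _ _ "{(x, 0)}" "{(y, 1)}"] by (intro Sup_least) auto
qed

end
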